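(* Let $\mathcal{C}_\Pi$ be a K3 model, let $\mathcal{L}\in\mathsf{Top}_\Pi$, and let $\mathsf{L}:\Gamma^{4,20}\to\Gamma^{4,20}$ be the associated lattice endomorphism. Suppose there is some $\Psi\in\Gamma^{4,20}$, $\Psi\neq 0$, such that $\mathsf{L}(\Psi)=\langle\mathcal{L}\rangle\Psi$, where $\langle\mathcal{L}\rangle$ is the quantum dimension of $\mathcal{L}$. Then $\langle\mathcal{L}\rangle$ is an integer. In particular, if for a certain model $\mathcal{C}_\Pi$ one has $\Pi\cap\Gamma^{4,20}\neq 0$, then all $\mathcal{L}\in\mathsf{Top}_\Pi$ have integral quantum dimension.
   Context: Defects. In a unitary two-dimensional CFT with space of states $\mathcal{H}$ and unique vacuum $|0\rangle$, a topological defect line $\mathcal{L}$ is an oriented line operator whose support can be deformed without changing correlation functions as long as it does not cross other insertions. Wrapping $\mathcal{L}$ around the circle of the cylinder gives a linear operator $\hat{\mathcal{L}}:\mathcal{H}\to\mathcal{H}$, and the quantum dimension is $\langle\mathcal{L}\rangle=\langle 0|\hat{\mathcal{L}}|0\rangle$ (assumed finite; it is a real number $\ge 1$). $\mathcal{L}$ is transparent to a local operator $\phi$ if it can be moved past $\phi$ without changing any correlation function. K3 models. A K3 model is a supersymmetric non-linear sigma model on a K3 surface: a unitary SCFT with small $\mathcal{N}=(4,4)$ superconformal algebra at $c=\tilde c=6$, invariant under spectral flow. The real space $V$ of CPT self-conjugate R-R ground states ($h=\tilde h=\frac14$) has dimension $24$ and splits as $V=\Pi\oplus\Pi^\perp$,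 with $\Pi$ the $4$-dimensional space of spectral flow generators (in the $\mathcal{N}=(4,4)$ representation with weights $\frac14$ and $SU(2)$ R-symmetry spins $(\frac12,\frac12)$) and $\Pi^\perp$ the $20$-dimensional space of R-symmetry singlets. $V$ carries a bilinear form of signature $(4,20)$, positive definite on $\Pi$ and negative definite on $\Pi^\perp$, and contains the even unimodular lattice $\Gamma^{4,20}$ of signature $(4,20)$ (dual of the lattice of R-R charges of 1/2-BPS D-branes), with $V\cong\Gamma^{4,20}\otimes\mathbb{R}$. The model determined by the subspace $\Pi\subset\Gamma^{4,20}\otimes\mathbb{R}$ is denoted $\mathcal{C}_\Pi$. $\mathsf{Top}_\Pi$ denotes the category of topological defects of $\mathcal{C}_\Pi$ that are transparent to all currents of the $\mathcal{N}=(4,4)$ superconformal algebra and to the spectral flow generators. For $\mathcal{L}\in\mathsf{Top}_\Pi$, write $\mathsf{L}:=\hat{\mathcal{L}}_{|V}:V\to V$. It has the following properties: (a) since fusion with $\mathcal{L}$ maps 1/2-BPS boundary states to 1/2-BPS boundary states, $\mathsf{L}$ maps $\Gamma^{4,20}$ into itself, i.e. it is the $\mathbb{R}$-linear extension of a $\mathbb{Z}$-linear endomorphism of $\Gamma^{4,20}$ (denoted by the same symbol); (b) $\mathsf{L}(\Pi)\subseteq\Pi$, $\mathsf{L}(\Pi^\perp)\subseteq\Pi^\perp$, and $\mathsf{L}_{|\Pi}=\langle\mathcal{L}\rangle\,\mathrm{id}_\Pi$. *)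

theory Defs
  imports Complex_Main "HOL-Library.FuncSet"
begin

section \<open>Data of a superconformal field theory with defects\<close>

text \<open>
  \<open>'h\<close> is the space of finite-energy states, \<open>'d\<close> the type of oriented line defects, and \<open>'c\<close>
  the type of correlators (worldsheets with inserted local operators and defect lines).  Local
  operators are identified with states by the state-operator correspondence.
\<close>

datatype chirality = Lft | Rgt

text \<open>
  The supercurrents \<open>G1, G2\<close> and their conjugates \<open>Gb1, Gb2\<close> are indexed by twice the mode number:
  \<open>G1 M c p\<close> is the mode with index \<open>p / 2\<close>, so \<open>p\<close> is odd on NS-NS states and even on R-R states.
  The modes \<open>Jp, Jm\<close> are those of \<open>J1 + \<i> J2\<close> and \<open>J1 - \<i> J2\<close>.
\<close>

record ('h, 'd, 'c) scft =
  scl :: "complex \<Rightarrow> 'h \<Rightarrow> 'h"                    \<comment> \<open>complex scalar multiplication\<close>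
  ip :: "'h \<Rightarrow> 'h \<Rightarrow> complex"                     \<comment> \<open>hermitian, linear in the second argument\<close>
  NSNS :: "'h set"
  RR :: "'h set"
  vac :: 'h
  Vir :: "chirality \<Rightarrow> int \<Rightarrow> 'h \<Rightarrow> 'h"
  J3 :: "chirality \<Rightarrow> int \<Rightarrow> 'h \<Rightarrow> 'h"
  Jp :: "chirality \<Rightarrow> int \<Rightarrow> 'h \<Rightarrow> 'h"
  Jm :: "chirality \<Rightarrow> int \<Rightarrow> 'h \<Rightarrow> 'h"
  G1 :: "chirality \<Rightarrow> int \<Rightarrow> 'h \<Rightarrow> 'h"
  G2 :: "chirality \<Rightarrow> int \<Rightarrow> 'h \<Rightarrow> 'h"
  Gb1 :: "chirality \<Rightarrow> int \<Rightarrow> 'h \<Rightarrow> 'h"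
  Gb2 :: "chirality \<Rightarrow> int \<Rightarrow> 'h \<Rightarrow> 'h"
  cpt :: "'h \<Rightarrow> 'h"
  form :: "'h \<Rightarrow> 'h \<Rightarrow> real"                      \<comment> \<open>bilinear form on the real R-R ground states\<close>
  charges :: "('h \<Rightarrow> real) set"                 \<comment> \<open>R-R charges of 1/2-BPS D-branes\<close>
  corr :: "'c \<Rightarrow> complex"                        \<comment> \<open>value of a correlator\<close>
  deform :: "'d \<Rightarrow> ('c \<times> 'c) set"               \<comment> \<open>deform the support without crossing any insertion\<close>
  cross :: "'d \<Rightarrow> 'h \<Rightarrow> ('c \<times> 'c) set"           \<comment> \<open>move the defect past an insertion of the operator\<close>
  cyl :: "'h \<Rightarrow> 'd \<Rightarrow> 'h \<Rightarrow> 'c"                   \<comment> \<open>cylinder, defect wrapping the circle, given end states\<close>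
  hat :: "'d \<Rightarrow> 'h \<Rightarrow> 'h"                         \<comment> \<open>operator obtained by wrapping the circle\<close>


section \<open>The state space and the small N=(4,4) algebra\<close>

locale hermitian_space =
  fixes M :: "('h::real_vector, 'd, 'c) scft"
  assumes scl: "vector_space (scl M)"
    and scl_real: "scl M (of_real r) x = r *\<^sub>R x"
    and ip_linear: "Vector_Spaces.linear (scl M) (*) (ip M x)"
    and ip_commute: "ip M y x = cnj (ip M x y)"
    and ip_pos: "x \<noteq> 0 \<Longrightarrow> 0 < Re (ip M x x)"

definition comm :: "('h::real_vector \<Rightarrow> 'h) \<Rightarrow> ('h \<Rightarrow> 'h) \<Rightarrow> 'h \<Rightarrow> 'h"
  where "comm A B v = A (B v) - B (A v)"

definition anticomm :: "('h::real_vector \<Rightarrow> 'h) \<Rightarrow> ('h \<Rightarrow> 'h) \<Rightarrow> 'h \<Rightarrow> 'h"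
  where "anticomm A B v = A (B v) + B (A v)"

definition bosonic_modes :: "('h, 'd, 'c) scft \<Rightarrow> chirality \<Rightarrow> ('h \<Rightarrow> 'h) set"
  where "bosonic_modes M c = (\<Union>n. {Vir M c n, J3 M c n, Jp M c n, Jm M c n})"

definition fermionic_modes :: "('h, 'd, 'c) scft \<Rightarrow> chirality \<Rightarrow> int \<Rightarrow> ('h \<Rightarrow> 'h) set"
  where "fermionic_modes M c p = {G1 M c p, G2 M c p, Gb1 M c p, Gb2 M c p}"

text \<open>The sector on which supercurrent modes with doubled index of the parity of \<open>p\<close> act.\<close>

definition sector :: "('h, 'd, 'c) scft \<Rightarrow> int \<Rightarrow> 'h set"
  where "sector M p = (if even p then RR M else NSNS M)"

text \<open>
  The small N=4 algebra at \<open>c = 6k\<close> and \<open>k = 1\<close>, in the form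
  \<open>{G\<^sup>a\<^sub>r, Gb\<^sup>b\<^sub>s} = 2 \<delta>\<^sup>a\<^sup>b L\<^sub>r\<^sub>+\<^sub>s - 2 (r - s) \<sigma>\<^sup>i\<^sub>a\<^sub>b J\<^sup>i\<^sub>r\<^sub>+\<^sub>s + k/2 (4 r\<^sup>2 - 1) \<delta>\<^sup>a\<^sup>b \<delta>\<^sub>r\<^sub>+\<^sub>s\<close>,
  \<open>[J\<^sup>i\<^sub>m, G\<^sup>a\<^sub>r] = - 1/2 \<sigma>\<^sup>i\<^sub>a\<^sub>b G\<^sup>b\<^sub>m\<^sub>+\<^sub>r\<close> and \<open>[J\<^sup>i\<^sub>m, Gb\<^sup>a\<^sub>r] = 1/2 cnj(\<sigma>\<^sup>i\<^sub>a\<^sub>b) Gb\<^sup>b\<^sub>m\<^sub>+\<^sub>r\<close>,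
  with the Pauli matrices written out and \<open>r = p / 2\<close>, \<open>s = q / 2\<close>.
\<close>

locale small_N4 = hermitian_space M
  for M :: "('h::real_vector, 'd, 'c) scft" and c :: chirality +
  assumes boson_linear: "A \<in> bosonic_modes M c \<Longrightarrow> Vector_Spaces.linear (scl M) (scl M) A"
    and boson_sector: "A \<in> bosonic_modes M c \<Longrightarrow> v \<in> sector M p \<Longrightarrow> A v \<in> sector M p"
    and fermion_linear: "A \<in> fermionic_modes M c p \<Longrightarrow> Vector_Spaces.linear (scl M) (scl M) A"
    and fermion_sector: "A \<in> fermionic_modes M c p \<Longrightarrow> v \<in> sector M p \<Longrightarrow> A v \<in> sector M p"
    \<comment> \<open>Virasoro algebra at central charge 6\<close>
    and Vir_Vir: "comm (Vir M c m) (Vir M c n) v =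
        scl M (of_int (m - n)) (Vir M c (m + n) v)
        + (if m + n = 0 then scl M (6 / 12 * (of_int m ^ 3 - of_int m)) v else 0)"
    and Vir_J3: "comm (Vir M c m) (J3 M c n) v = scl M (- of_int n) (J3 M c (m + n) v)"
    and Vir_Jp: "comm (Vir M c m) (Jp M c n) v = scl M (- of_int n) (Jp M c (m + n) v)"
    and Vir_Jm: "comm (Vir M c m) (Jm M c n) v = scl M (- of_int n) (Jm M c (m + n) v)"
    \<comment> \<open>affine su(2) at level 1\<close>
    and J3_J3: "comm (J3 M c m) (J3 M c n) v = (if m + n = 0 then scl M (of_int m / 2) v else 0)"
    and J3_Jp: "comm (J3 M c m) (Jp M c n) v = Jp M c (m + n) v"
    and J3_Jm: "comm (J3 M c m) (Jm M c n) v = - Jm M c (m + n) v"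
    and Jp_Jm: "comm (Jp M c m) (Jm M c n) v =
        scl M 2 (J3 M c (m + n) v) + (if m + n = 0 then scl M (of_int m) v else 0)"
    and Jp_Jp: "comm (Jp M c m) (Jp M c n) v = 0"
    and Jm_Jm: "comm (Jm M c m) (Jm M c n) v = 0"
    \<comment> \<open>action on the supercurrents\<close>
    and Vir_G1: "v \<in> sector M p \<Longrightarrow>
        comm (Vir M c m) (G1 M c p) v = scl M (of_int (m - p) / 2) (G1 M c (2 * m + p) v)"
    and Vir_G2: "v \<in> sector M p \<Longrightarrow>
        comm (Vir M c m) (G2 M c p) v = scl M (of_int (m - p) / 2) (G2 M c (2 * m + p) v)"
    and Vir_Gb1: "v \<in> sector M p \<Longrightarrow>
        comm (Vir M c m) (Gb1 M c p) v = scl M (of_int (m - p) / 2) (Gb1 M c (2 * m + p) v)"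
    and Vir_Gb2: "v \<in> sector M p \<Longrightarrow>
        comm (Vir M c m) (Gb2 M c p) v = scl M (of_int (m - p) / 2) (Gb2 M c (2 * m + p) v)"
    and J3_G1: "v \<in> sector M p \<Longrightarrow>
        comm (J3 M c m) (G1 M c p) v = scl M (- 1 / 2) (G1 M c (2 * m + p) v)"
    and J3_G2: "v \<in> sector M p \<Longrightarrow>
        comm (J3 M c m) (G2 M c p) v = scl M (1 / 2) (G2 M c (2 * m + p) v)"
    and J3_Gb1: "v \<in> sector M p \<Longrightarrow>
        comm (J3 M c m) (Gb1 M c p) v = scl M (1 / 2) (Gb1 M c (2 * m + p) v)"
    and J3_Gb2: "v \<in> sector M p \<Longrightarrow>
        comm (J3 M c m) (Gb2 M c p) v = scl M (- 1 / 2) (Gb2 M c (2 * m + p) v)"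
    and Jp_G1: "v \<in> sector M p \<Longrightarrow> comm (Jp M c m) (G1 M c p) v = - G2 M c (2 * m + p) v"
    and Jp_G2: "v \<in> sector M p \<Longrightarrow> comm (Jp M c m) (G2 M c p) v = 0"
    and Jp_Gb1: "v \<in> sector M p \<Longrightarrow> comm (Jp M c m) (Gb1 M c p) v = 0"
    and Jp_Gb2: "v \<in> sector M p \<Longrightarrow> comm (Jp M c m) (Gb2 M c p) v = Gb1 M c (2 * m + p) v"
    and Jm_G1: "v \<in> sector M p \<Longrightarrow> comm (Jm M c m) (G1 M c p) v = 0"
    and Jm_G2: "v \<in> sector M p \<Longrightarrow> comm (Jm M c m) (G2 M c p) v = - G1 M c (2 * m + p) v"
    and Jm_Gb1: "v \<in> sector M p \<Longrightarrow> comm (Jm M c m) (Gb1 M c p) v = Gb2 M c (2 * m + p) v"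
    and Jm_Gb2: "v \<in> sector M p \<Longrightarrow> comm (Jm M c m) (Gb2 M c p) v = 0"
    \<comment> \<open>anticommutators of the supercurrents\<close>
    and G_G: "even p = even q \<Longrightarrow> v \<in> sector M p \<Longrightarrow>
        A \<in> {G1 M c p, G2 M c p} \<Longrightarrow> B \<in> {G1 M c q, G2 M c q} \<Longrightarrow> anticomm A B v = 0"
    and Gb_Gb: "even p = even q \<Longrightarrow> v \<in> sector M p \<Longrightarrow>
        A \<in> {Gb1 M c p, Gb2 M c p} \<Longrightarrow> B \<in> {Gb1 M c q, Gb2 M c q} \<Longrightarrow> anticomm A B v = 0"
    and G1_Gb1: "even p = even q \<Longrightarrow> v \<in> sector M p \<Longrightarrow>
        anticomm (G1 M c p) (Gb1 M c q) v =
          scl M 2 (Vir M c ((p + q) div 2) v) - scl M (of_int (p - q)) (J3 M c ((p + q) div 2) v)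
          + (if p + q = 0 then scl M (1 / 2 * (of_int p ^ 2 - 1)) v else 0)"
    and G1_Gb2: "even p = even q \<Longrightarrow> v \<in> sector M p \<Longrightarrow>
        anticomm (G1 M c p) (Gb2 M c q) v = - scl M (of_int (p - q)) (Jm M c ((p + q) div 2) v)"
    and G2_Gb1: "even p = even q \<Longrightarrow> v \<in> sector M p \<Longrightarrow>
        anticomm (G2 M c p) (Gb1 M c q) v = - scl M (of_int (p - q)) (Jp M c ((p + q) div 2) v)"
    and G2_Gb2: "even p = even q \<Longrightarrow> v \<in> sector M p \<Longrightarrow>
        anticomm (G2 M c p) (Gb2 M c q) v =
          scl M 2 (Vir M c ((p + q) div 2) v) + scl M (of_int (p - q)) (J3 M c ((p + q) div 2) v)
          + (if p + q = 0 then scl M (1 / 2 * (of_int p ^ 2 - 1)) v else 0)"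
    \<comment> \<open>unitarity\<close>
    and Vir_adj: "ip M x (Vir M c n y) = ip M (Vir M c (- n) x) y"
    and J3_adj: "ip M x (J3 M c n y) = ip M (J3 M c (- n) x) y"
    and Jp_adj: "ip M x (Jp M c n y) = ip M (Jm M c (- n) x) y"
    and G1_adj: "x \<in> sector M p \<Longrightarrow> y \<in> sector M p \<Longrightarrow>
        ip M x (G1 M c p y) = ip M (Gb1 M c (- p) x) y"
    and G2_adj: "x \<in> sector M p \<Longrightarrow> y \<in> sector M p \<Longrightarrow>
        ip M x (G2 M c p y) = ip M (Gb2 M c (- p) x) y"

text \<open>
  Spectral flow by half a unit in both chiralities: a unitary map \<open>U\<close> from the NS-NS to the R-R
  sector implementing the corresponding automorphism of the algebra.  It raises each of the two
  \<open>J3\<close>-charges by 1/2 and maps the vacuum to a state with weights (1/4, 1/4).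
\<close>

definition half_flow :: "('h::real_vector, 'd, 'c) scft \<Rightarrow> ('h \<Rightarrow> 'h) \<Rightarrow> bool"
  where "half_flow M U \<longleftrightarrow>
    bij_betw U (NSNS M) (RR M) \<and>
    (\<forall>x\<in>NSNS M. \<forall>y\<in>NSNS M. U (x + y) = U x + U y \<and> ip M (U x) (U y) = ip M x y) \<and>
    (\<forall>a. \<forall>x\<in>NSNS M. U (scl M a x) = scl M a (U x)) \<and>
    (\<forall>c n. \<forall>x\<in>NSNS M.
       Vir M c n (U x) = U (Vir M c n x + J3 M c n x + (if n = 0 then scl M (1 / 4) x else 0)) \<and>
       J3 M c n (U x) = U (J3 M c n x + (if n = 0 then scl M (1 / 2) x else 0)) \<and>
       Jp M c n (U x) = U (Jp M c (n + 1) x) \<and>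
       Jm M c n (U x) = U (Jm M c (n - 1) x)) \<and>
    (\<forall>c p. even p \<longrightarrow> (\<forall>x\<in>NSNS M.
       G1 M c p (U x) = U (G1 M c (p - 1) x) \<and>
       G2 M c p (U x) = U (G2 M c (p + 1) x) \<and>
       Gb1 M c p (U x) = U (Gb1 M c (p + 1) x) \<and>
       Gb2 M c p (U x) = U (Gb2 M c (p - 1) x)))"

locale unitary_N44_scft = left: small_N4 M Lft + right: small_N4 M Rgt
  for M :: "('h::real_vector, 'd, 'c) scft" +
  assumes sectors_closed: "x \<in> sector M p \<Longrightarrow> y \<in> sector M p \<Longrightarrow> x + scl M a y \<in> sector M p"
    and sectors_zero: "0 \<in> sector M p"
    and sectors_sum: "\<exists>x\<in>NSNS M. \<exists>y\<in>RR M. v = x + y"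
    and sectors_orthogonal: "x \<in> NSNS M \<Longrightarrow> y \<in> RR M \<Longrightarrow> ip M x y = 0"
    and finite_energy: "span {v. \<exists>h h'. h \<ge> 0 \<and> h' \<ge> 0 \<and>
        Vir M Lft 0 v = h *\<^sub>R v \<and> Vir M Rgt 0 v = h' *\<^sub>R v} = UNIV"
    and left_right_boson: "A \<in> bosonic_modes M Lft \<Longrightarrow> B \<in> bosonic_modes M Rgt \<Longrightarrow> comm A B v = 0"
    and left_right_mixed: "c \<noteq> c' \<Longrightarrow> A \<in> bosonic_modes M c \<Longrightarrow> B \<in> fermionic_modes M c' p \<Longrightarrow>
        v \<in> sector M p \<Longrightarrow> comm A B v = 0"
    and left_right_fermion: "even p = even q \<Longrightarrow> A \<in> fermionic_modes M Lft p \<Longrightarrow>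
        B \<in> fermionic_modes M Rgt q \<Longrightarrow> v \<in> sector M p \<Longrightarrow> anticomm A B v = 0"
    and vac_NSNS: "vac M \<in> NSNS M"
    and vac_norm: "ip M (vac M) (vac M) = 1"
    and vac_weight: "Vir M c 0 (vac M) = 0"
    and vac_unique: "Vir M Lft 0 v = 0 \<Longrightarrow> Vir M Rgt 0 v = 0 \<Longrightarrow> \<exists>a. v = scl M a (vac M)"
    and spectral_flow: "\<exists>U. half_flow M U"


section \<open>R-R ground states and the lattice\<close>

definition rr_ground_states :: "('h::real_vector, 'd, 'c) scft \<Rightarrow> 'h set"
  where "rr_ground_states M =
    {v \<in> RR M. Vir M Lft 0 v = (1 / 4) *\<^sub>R v \<and> Vir M Rgt 0 v = (1 / 4) *\<^sub>R v}"

definition real_ground_states :: "('h::real_vector, 'd, 'c) scft \<Rightarrow> 'h set"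
  where "real_ground_states M = {v \<in> rr_ground_states M. cpt M v = v}"

definition has_spin :: "('h::real_vector, 'd, 'c) scft \<Rightarrow> chirality \<Rightarrow> real \<Rightarrow> 'h \<Rightarrow> bool"
  where "has_spin M c j v \<longleftrightarrow>
    J3 M c 0 (J3 M c 0 v) + (1 / 2) *\<^sub>R (Jp M c 0 (Jm M c 0 v) + Jm M c 0 (Jp M c 0 v))
      = (j * (j + 1)) *\<^sub>R v"

text \<open>The subspaces \<open>\<Pi>\<close> and \<open>\<Pi>\<^sup>\<bottom>\<close> of \<open>V\<close>.\<close>

definition flow_generators :: "('h::real_vector, 'd, 'c) scft \<Rightarrow> 'h set"
  where "flow_generators M =
    {v \<in> real_ground_states M. has_spin M Lft (1 / 2) v \<and> has_spin M Rgt (1 / 2) v}"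

definition singlets :: "('h::real_vector, 'd, 'c) scft \<Rightarrow> 'h set"
  where "singlets M = {v \<in> real_ground_states M. has_spin M Lft 0 v \<and> has_spin M Rgt 0 v}"

definition bps_lattice :: "('h::real_vector, 'd, 'c) scft \<Rightarrow> 'h set"
  where "bps_lattice M = {v \<in> real_ground_states M. \<forall>q\<in>charges M. q v \<in> \<int>}"

definition full_lattice_in :: "'h::real_vector set \<Rightarrow> 'h set \<Rightarrow> bool"
  where "full_lattice_in W \<Gamma> \<longleftrightarrow>
    (\<exists>B. finite B \<and> independent B \<and> span B = W \<and>
         \<Gamma> = {(\<Sum>b\<in>B. of_int (n b) *\<^sub>R b) | n :: 'h \<Rightarrow> int. True})"

text \<open>
  The form is only constrained on \<open>V\<close>; its signature (4,20) is given by the dimensions and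
  definiteness of the orthogonal summands.
\<close>

locale K3_model = unitary_N44_scft M
  for M :: "('h::real_vector, 'd, 'c) scft" +
  assumes cpt_add: "cpt M (x + y) = cpt M x + cpt M y"
    and cpt_scl: "cpt M (scl M a x) = scl M (cnj a) (cpt M x)"
    and cpt_ip: "ip M (cpt M x) (cpt M y) = cnj (ip M x y)"
    and cpt_RR: "x \<in> RR M \<Longrightarrow> cpt M x \<in> RR M"
    and cpt_weight: "cpt M (Vir M c 0 x) = Vir M c 0 (cpt M x)"
    and cpt_invol: "x \<in> rr_ground_states M \<Longrightarrow> cpt M (cpt M x) = x"
    and V_dim: "dim (real_ground_states M) = 24"
    and Pi_dim: "dim (flow_generators M) = 4"
    and Pi_perp_dim: "dim (singlets M) = 20"
    and V_sum: "real_ground_states M = {x + y | x y. x \<in> flow_generators M \<and> y \<in> singlets M}"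
    and form_add: "x \<in> real_ground_states M \<Longrightarrow> y \<in> real_ground_states M \<Longrightarrow>
        z \<in> real_ground_states M \<Longrightarrow> form M (x + y) z = form M x z + form M y z"
    and form_scale: "x \<in> real_ground_states M \<Longrightarrow> z \<in> real_ground_states M \<Longrightarrow>
        form M (r *\<^sub>R x) z = r * form M x z"
    and form_sym: "x \<in> real_ground_states M \<Longrightarrow> y \<in> real_ground_states M \<Longrightarrow>
        form M x y = form M y x"
    and form_orthogonal: "x \<in> flow_generators M \<Longrightarrow> y \<in> singlets M \<Longrightarrow> form M x y = 0"
    and form_pos: "x \<in> flow_generators M \<Longrightarrow> x \<noteq> 0 \<Longrightarrow> form M x x > 0"
    and form_neg: "x \<in> singlets M \<Longrightarrow> x \<noteq> 0 \<Longrightarrow> form M x x < 0"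
    and charges_add: "q \<in> charges M \<Longrightarrow> x \<in> real_ground_states M \<Longrightarrow> y \<in> real_ground_states M \<Longrightarrow>
        q (x + y) = q x + q y"
    and charges_scale: "q \<in> charges M \<Longrightarrow> x \<in> real_ground_states M \<Longrightarrow> q (r *\<^sub>R x) = r * q x"
    and lattice: "full_lattice_in (real_ground_states M) (bps_lattice M)"
    and unimodular:
      "{v \<in> real_ground_states M. \<forall>w\<in>bps_lattice M. form M v w \<in> \<int>} = bps_lattice M"
    and even: "v \<in> bps_lattice M \<Longrightarrow> \<exists>k::int. form M v v = 2 * of_int k"


section \<open>Topological defects\<close>

definition topological :: "('h, 'd, 'c) scft \<Rightarrow> 'd \<Rightarrow> bool"
  where "topological M D \<longleftrightarrow> (\<forall>(x, y) \<in> deform M D. corr M x = corr M y)"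

definition transparent :: "('h, 'd, 'c) scft \<Rightarrow> 'd \<Rightarrow> 'h \<Rightarrow> bool"
  where "transparent M D \<phi> \<longleftrightarrow> (\<forall>(x, y) \<in> cross M D \<phi>. corr M x = corr M y)"

definition currents :: "('h, 'd, 'c) scft \<Rightarrow> 'h set"
  where "currents M = (\<Union>c.
    {Vir M c (- 2) (vac M), J3 M c (- 1) (vac M), Jp M c (- 1) (vac M), Jm M c (- 1) (vac M),
     G1 M c (- 3) (vac M), G2 M c (- 3) (vac M), Gb1 M c (- 3) (vac M), Gb2 M c (- 3) (vac M)})"

definition Top :: "('h::real_vector, 'd, 'c) scft \<Rightarrow> 'd set"
  where "Top M = {D. topological M D \<and> (\<forall>\<phi> \<in> currents M \<union> flow_generators M. transparent M D \<phi>)}"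

definition qdim :: "('h, 'd, 'c) scft \<Rightarrow> 'd \<Rightarrow> complex"
  where "qdim M D = ip M (vac M) (hat M D (vac M))"

definition ground_map :: "('h::real_vector, 'd, 'c) scft \<Rightarrow> 'd \<Rightarrow> 'h \<Rightarrow> 'h"
  where "ground_map M D = restrict (hat M D) (real_ground_states M)"

text \<open>
  The axioms about \<open>ground_map\<close> are the properties of defects in \<open>Top\<close> that follow from the
  physics of boundary states and of transparency; they are taken as given.
\<close>

locale K3_model_with_defects = K3_model M
  for M :: "('h::real_vector, 'd, 'c) scft" +
  assumes hat_linear: "topological M D \<Longrightarrow> Vector_Spaces.linear (scl M) (scl M) (hat M D)"
    and hat_cyl: "topological M D \<Longrightarrow> ip M x (hat M D y) = corr M (cyl M x D y)"
    and qdim_real: "topological M D \<Longrightarrow> qdim M D \<in> \<real>"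
    and qdim_ge_1: "topological M D \<Longrightarrow> Re (qdim M D) \<ge> 1"
    and ground_map_V: "D \<in> Top M \<Longrightarrow> ground_map M D ` real_ground_states M \<subseteq> real_ground_states M"
    and ground_map_lattice: "D \<in> Top M \<Longrightarrow> ground_map M D ` bps_lattice M \<subseteq> bps_lattice M"
    and ground_map_Pi: "D \<in> Top M \<Longrightarrow> ground_map M D ` flow_generators M \<subseteq> flow_generators M"
    and ground_map_Pi_perp: "D \<in> Top M \<Longrightarrow> ground_map M D ` singlets M \<subseteq> singlets M"
    and ground_map_Pi_scalar: "D \<in> Top M \<Longrightarrow> v \<in> flow_generators M \<Longrightarrow>
        ground_map M D v = scl M (qdim M D) v"

end

theory Submission
  imports Defs
begin

text \<open>
  If \<open>L v = d v\<close> for a lattice vector \<open>v\<close>, then \<open>frac d\<close> times \<open>v\<close> is \<open>L v\<close> minus an integer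
  multiple of \<open>v\<close>, hence again a lattice vector and an eigenvector for \<open>d\<close>.  Taking \<open>v\<close> such that a
  fixed lattice coordinate is nonzero and minimal in absolute value forces \<open>frac d = 0\<close>.
\<close>

text \<open>By independence the integer coefficients of a lattice vector are its coordinates in
  \<open>B\<close>. Lattice membership inside \<open>W\<close> thus becomes integrality of each
  coordinate, which can be checked on real multiples of a vector.\<close>

lemma full_lattice_in_coordinates:
  assumes "full_lattice_in W \<Gamma>"
  obtains B where "independent B" "span B = W"
    "\<And>v. v \<in> \<Gamma> \<longleftrightarrow> v \<in> W \<and> (\<forall>b\<in>B. representation B v b \<in> \<int>)"
proof -
  from assms obtain B where B: "finite B" "independent B" "span B = W"
    and \<Gamma>: "\<Gamma> = {(\<Sum>b\<in>B. of_int (n b) *\<^sub>R b) | n :: 'a \<Rightarrow> int. True}"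
    unfolding full_lattice_in_def by blast
  have "v \<in> \<Gamma> \<longleftrightarrow> v \<in> W \<and> (\<forall>b\<in>B. representation B v b \<in> \<int>)" for v
  proof
    assume "v \<in> \<Gamma>"
    then obtain n :: "'a \<Rightarrow> int" where v: "v = (\<Sum>b\<in>B. of_int (n b) *\<^sub>R b)"
      using \<Gamma> by blast
    have "representation B v b = of_int (n b)" if "b \<in> B" for b
    proof -
      have "representation B v b = (\<Sum>c\<in>B. of_int (n c) * representation B c b)"
        unfolding v using B(2)
        by (subst representation_sum) (auto simp: representation_scale span_base span_scale)
      also have "\<dots> = (\<Sum>c\<in>B. if c = b then of_int (n c) else 0)"
        using B(2) by (intro sum.cong) (auto simp: representation_basis)
      finally show ?thesis
        using B(1) that by simp
    qed
    moreover have "v \<in> W"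
      unfolding v B(3)[symmetric] by (intro span_sum span_scale span_base)
    ultimately show "v \<in> W \<and> (\<forall>b\<in>B. representation B v b \<in> \<int>)"
      by simp
  next
    assume v: "v \<in> W \<and> (\<forall>b\<in>B. representation B v b \<in> \<int>)"
    have "v = (\<Sum>b\<in>B. representation B v b *\<^sub>R b)"
      using B v by (simp add: sum_representation_eq)
    also have "\<dots> = (\<Sum>b\<in>B. of_int \<lfloor>representation B v b\<rfloor> *\<^sub>R b)"
      using v by (intro sum.cong) (auto elim: Ints_cases)
    finally show "v \<in> \<Gamma>"
      unfolding \<Gamma> by (intro CollectI exI[where x = "\<lambda>b. \<lfloor>representation B v b\<rfloor>"]) simp
  qed
  with B that show ?thesis by blast
qed

lemma lattice_eigenvalue_Ints:
  fixes L :: "'a::real_vector \<Rightarrow> 'a" and d :: real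
  assumes lattice: "full_lattice_in W \<Gamma>"
    and L_scale: "\<And>r x. L (r *\<^sub>R x) = r *\<^sub>R L x"
    and L_lattice: "L ` \<Gamma> \<subseteq> \<Gamma>"
    and v: "v \<in> \<Gamma>" "v \<noteq> 0" "L v = d *\<^sub>R v"
  shows "d \<in> \<int>"
proof -
  from lattice obtain B where B: "independent B" "span B = W"
    and mem: "\<And>v. v \<in> \<Gamma> \<longleftrightarrow> v \<in> W \<and> (\<forall>b\<in>B. representation B v b \<in> \<int>)"
    by (rule full_lattice_in_coordinates) blast
  obtain b where b: "b \<in> B" "representation B v b \<noteq> 0"
  proof (rule ccontr)
    assume "\<not> thesis"
    with that have "representation B v b = 0" for b
      using representation_ne_zero by blast
    moreover have "v \<in> span B"
      using v(1) mem B(2) by simp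
    ultimately show False
      using v(2) sum_nonzero_representation_eq[OF B(1), of v] by simp
  qed
  \<comment> \<open>A natural number, so that a minimal value exists; on \<Gamma> the floor is exact
    because the coordinate is an integer.\<close>
  define coord where "coord w = nat \<lfloor>\<bar>representation B w b\<bar>\<rfloor>" for w
  have coord: "real (coord w) = \<bar>representation B w b\<bar>" if "w \<in> \<Gamma>" for w
    using that mem b(1) unfolding coord_def by (auto elim!: Ints_cases)
  \<comment> \<open>Asking for \<open>coord w \<noteq> 0\<close> rather than
    \<open>w \<noteq> 0\<close> makes the single coordinate at \<open>b\<close> a measure for the
    descent.\<close>
  define E where "E w \<longleftrightarrow> w \<in> \<Gamma> \<and> L w = d *\<^sub>R w \<and> coord w \<noteq> 0" for w
  have "E v"
    using v b(2) coord[of v] unfolding E_def by auto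
  then obtain w where "E w" and minimal: "\<And>u. E u \<Longrightarrow> coord w \<le> coord u"
    using exists_least_iff[of "\<lambda>n. \<exists>w. E w \<and> coord w = n"] by (metis leI)
  then have w: "w \<in> \<Gamma>" "L w = d *\<^sub>R w" "coord w \<noteq> 0"
    unfolding E_def by auto
  let ?u = "frac d *\<^sub>R w"
  have "w \<in> span B" "d *\<^sub>R w \<in> \<Gamma>"
    using w L_lattice mem B(2) by force+
  have rep: "representation B (r *\<^sub>R w) c = r * representation B w c" for r c
    using \<open>w \<in> span B\<close> B(1) by (simp add: representation_scale)
  have "representation B ?u c \<in> \<int>" if "c \<in> B" for c
  proof -
    \<comment> \<open>Both terms are integers: \<open>d *\<^sub>R w\<close> is \<open>L w\<close>,
      which lies in \<Gamma>, and \<open>w\<close> itself lies in \<Gamma>.\<close>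
    have "representation B ?u c
        = representation B (d *\<^sub>R w) c - of_int \<lfloor>d\<rfloor> * representation B w c"
      unfolding rep frac_def by (simp add: left_diff_distrib)
    then show ?thesis
      using that mem \<open>d *\<^sub>R w \<in> \<Gamma>\<close> w(1) by simp
  qed
  then have "?u \<in> \<Gamma>"
    using mem B(2) \<open>w \<in> span B\<close> span_scale by blast
  moreover have "L ?u = d *\<^sub>R ?u"
    using w(2) L_scale by (simp add: mult.commute)
  moreover have coord_u: "real (coord ?u) = frac d * real (coord w)"
    using \<open>?u \<in> \<Gamma>\<close> w(1) by (simp add: coord rep abs_mult)
  have "frac d * real (coord w) < real (coord w)"
    using frac_lt_1[of d] w(3) by simp
  with coord_u have "coord ?u < coord w"
    by simp
  \<comment> \<open>Otherwise \<open>?u\<close> would satisfy \<open>E\<close> with a smaller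
    coordinate than the minimal one. As \<open>coord w\<close> is nonzero, the vanishing product
    then gives \<open>frac d = 0\<close>.\<close>
  ultimately have "coord ?u = 0"
    using minimal[of ?u] unfolding E_def by auto
  with coord_u w(3) show ?thesis
    by simp
qed

context K3_model
begin

lemma scl_of_real: "scl M (of_real r) x = r *\<^sub>R x"
  by (rule left.scl_real)

text \<open>Needed to decompose 0 by \<open>V_sum\<close> and to evaluate charges at 0. The
  conditions defining V hold at 0 by additivity of \<open>cpt\<close> and linearity of the Virasoro
  modes.\<close>

lemma zero_real_ground_state: "0 \<in> real_ground_states M"
proof -
  have "cpt M 0 = 0"
    using cpt_add[of 0 0] by simp
  moreover have "0 \<in> RR M"
    using sectors_zero[of 0] unfolding sector_def by simp
  moreover have "Vir M Lft 0 0 = 0"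
  proof -
    interpret Vector_Spaces.linear "scl M" "scl M" "Vir M Lft 0"
      by (rule left.boson_linear) (auto simp: bosonic_modes_def)
    show ?thesis by (rule zero)
  qed
  moreover have "Vir M Rgt 0 0 = 0"
  proof -
    interpret Vector_Spaces.linear "scl M" "scl M" "Vir M Rgt 0"
      by (rule right.boson_linear) (auto simp: bosonic_modes_def)
    show ?thesis by (rule zero)
  qed
  ultimately show ?thesis
    unfolding real_ground_states_def rr_ground_states_def by simp
qed

text \<open>The \<open>\<Pi>\<close>-component of a decomposition of \<open>0\<close> is null for the form, hence zero.\<close>

lemma zero_flow_generator: "0 \<in> flow_generators M"
proof -
  obtain x y where xy: "x \<in> flow_generators M" "y \<in> singlets M" "0 = x + y"
    using zero_real_ground_state V_sum by auto
  then have V: "x \<in> real_ground_states M" "y \<in> real_ground_states M"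
    unfolding flow_generators_def singlets_def by auto
  \<comment> \<open>Expanding the form at \<open>0 = x + y\<close> leaves only
    \<open>form M x x\<close>, since the cross term vanishes by orthogonality. Writing 0 as
    \<open>0 *\<^sub>R x\<close> lets \<open>form_scale\<close> evaluate the result.\<close>
  have "form M x x = form M (0 *\<^sub>R x) x"
    using xy V form_add[of x y x] form_sym[of y x] form_orthogonal[of x y] by simp
  also have "\<dots> = 0"
    using form_scale[OF V(1) V(1), of 0] by simp
  finally show ?thesis
    using form_pos[of x] xy(1) by force
qed

lemma zero_bps_lattice: "0 \<in> bps_lattice M"
proof -
  have "q 0 = 0" if "q \<in> charges M" for q
    using charges_scale[OF that zero_real_ground_state, of 0] by simp
  then have "q 0 \<in> \<int>" if "q \<in> charges M" for q
    using that by (metis Ints_0)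
  then show ?thesis
    using zero_real_ground_state unfolding bps_lattice_def by blast
qed

end

context K3_model_with_defects
begin

text \<open>The quantum dimension is a complex number with real value \<open>d\<close>, and complex
  scaling by \<open>of_real d\<close> is real scaling, so the eigenvalue argument for real lattices
  applies.\<close>

lemma qdim_Ints_of_eigenvector:
  assumes D: "D \<in> Top M"
    and \<Psi>: "\<Psi> \<in> bps_lattice M" "\<Psi> \<noteq> 0" "ground_map M D \<Psi> = scl M (qdim M D) \<Psi>"
  shows "qdim M D \<in> \<int>"
proof -
  have top: "topological M D"
    using D unfolding Top_def by simp
  obtain d where d: "qdim M D = of_real d"
    using qdim_real[OF top] by (auto elim: Reals_cases)
  \<comment> \<open>\<open>ground_map\<close> is unspecified outside V, whereas
    \<open>hat M D\<close> is homogeneous everywhere; the two agree on the lattice.\<close>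
  have hat: "ground_map M D v = hat M D v" if "v \<in> bps_lattice M" for v
    using that unfolding ground_map_def bps_lattice_def by simp
  have "d \<in> \<int>"
  proof (rule lattice_eigenvalue_Ints[OF lattice])
    show "hat M D (r *\<^sub>R x) = r *\<^sub>R hat M D x" for r x
    proof -
      interpret hat: Vector_Spaces.linear "scl M" "scl M" "hat M D"
        by (rule hat_linear[OF top])
      show ?thesis
        using hat.scale[of "of_real r" x] unfolding scl_of_real .
    qed
    show "hat M D ` bps_lattice M \<subseteq> bps_lattice M"
      using ground_map_lattice[OF D] hat by auto
    show "hat M D \<Psi> = d *\<^sub>R \<Psi>"
      using \<Psi> hat[OF \<Psi>(1)] unfolding d scl_of_real by simp
  qed (use \<Psi> in auto)
  then show ?thesis
    unfolding d by (auto elim: Ints_cases)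
qed

end

theorem proposition4:
  fixes M :: "('h::real_vector, 'd, 'c) scft"
  assumes "K3_model_with_defects M"
  shows "(\<forall>D \<in> Top M.
            (\<exists>\<Psi> \<in> bps_lattice M. \<Psi> \<noteq> 0 \<and> ground_map M D \<Psi> = scl M (qdim M D) \<Psi>)
              \<longrightarrow> qdim M D \<in> \<int>)
       \<and> (flow_generators M \<inter> bps_lattice M \<noteq> {0} \<longrightarrow> (\<forall>D \<in> Top M. qdim M D \<in> \<int>))"
proof -
  interpret K3_model_with_defects M by fact
  have "qdim M D \<in> \<int>" if "D \<in> Top M" and nontrivial: "flow_generators M \<inter> bps_lattice M \<noteq> {0}" for D
  proof -
    \<comment> \<open>Since 0 lies in both sets, the intersection is not empty, and differing from
      \<open>{0}\<close> yields a nonzero vector. On \<Pi> the defect acts by its quantum dimension,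
      so this vector is the required eigenvector.\<close>
    obtain \<Psi> where "\<Psi> \<in> flow_generators M" "\<Psi> \<in> bps_lattice M" "\<Psi> \<noteq> 0"
      using nontrivial zero_flow_generator zero_bps_lattice by blast
    then show ?thesis
      using that qdim_Ints_of_eigenvector ground_map_Pi_scalar by blast
  qed
  then show ?thesis
    using qdim_Ints_of_eigenvector by blast
qed

end
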